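(* Let $L$ be one of the logics $\mathbf{S4D}$, $\mathbf{S4DS}$, $\mathbf{S4DT_1S}$. Then $L$ has the finite model property; that is, every bimodal formula $A\notin L$ is refuted in some finite Kripke frame $F=(W,R,R_D)$ validating all formulas of $L$.
   Context: Formulas are built by $\phi ::= p \mid \bot \mid \phi\to\phi \mid \Box\phi \mid [\neq]\phi$, with $p$ ranging over propositional letters; the other Boolean connectives are the usual abbreviations, $\Diamond A=\neg\Box\neg A$, $\langle\neq\rangle A=\neg[\neq]\neg A$, and $[\forall]A=[\neq]A\wedge A$. A (bimodal) logic is a set of formulas containing all classical tautologies, $\Box(p\to q)\to(\Box p\to\Box q)$ and $[\neq](p\to q)\to([\neq]p\to[\neq]q)$, and closed under Substitution, Modus Ponens, and the two Generalization rules $A/\Box A$ and $A/[\neq]A$. $\mathbf{K_2}$ is the minimal logic, and $L+\Gamma$ is the minimal logic containing the logic $L$ and the set of formulas $\Gamma$. $\mathbf{S4D}=\mathbf{K_2}+\{B_D,4_D^-,D_\Box,T_\Box,4_\Box\}$, $\mathbf{S4DS}=\mathbf{S4D}+DS$, $\mathbf{S4DT_1S}=\mathbf{S4DS}+AT_1$, where $B_D$ is $p\to[\neq]\langle\neq\rangle p$; $4_D^-$ is $(p\wedge[\neq]p)\to[\neq][\neq]p$; $D_\Box$ is $[\forall]p\to\Box p$; $T_\Box$ is $\Box p\to p$; $4_\Box$ is $\Box p\to\Box\Box p$; $DS$ is $[\neq]p\to\Diamond p$; $AT_1$ is $[\neq]p\to[\neq]\Box p$. A Kripke frame is $F=(W,R,R_D)$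 with $W$ a non-empty set and $R,R_D$ binary relations on $W$; a valuation $\theta$ assigns to each propositional letter a subset of $W$. Truth of formulas at points of the model $(F,\theta)$ is the usual Kripke truth, with $\Box$ interpreted by $R$ and $[\neq]$ interpreted by $R_D$. A formula is valid in $F$ if it is true at all points under all valuations, and refuted in $F$ otherwise. *)

theory Defs
  imports Main
begin

datatype fm =
    Var nat
  | Bot
  | Imp fm fm  (infixr "\<^bold>\<rightarrow>" 55)
  | Box fm
  | DBox fm  \<comment> \<open>the difference modality\<close>

abbreviation Neg :: "fm \<Rightarrow> fm" where "Neg A \<equiv> A \<^bold>\<rightarrow> Bot"
abbreviation Conj :: "fm \<Rightarrow> fm \<Rightarrow> fm" where "Conj A B \<equiv> Neg (A \<^bold>\<rightarrow> Neg B)"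
abbreviation Dia :: "fm \<Rightarrow> fm" where "Dia A \<equiv> Neg (Box (Neg A))"
abbreviation DDia :: "fm \<Rightarrow> fm" where "DDia A \<equiv> Neg (DBox (Neg A))"
abbreviation UBox :: "fm \<Rightarrow> fm" where "UBox A \<equiv> Conj (DBox A) A"

primrec subst :: "(nat \<Rightarrow> fm) \<Rightarrow> fm \<Rightarrow> fm" where
  "subst \<sigma> (Var n) = \<sigma> n"
| "subst \<sigma> Bot = Bot"
| "subst \<sigma> (A \<^bold>\<rightarrow> B) = subst \<sigma> A \<^bold>\<rightarrow> subst \<sigma> B"
| "subst \<sigma> (Box A) = Box (subst \<sigma> A)"
| "subst \<sigma> (DBox A) = DBox (subst \<sigma> A)"

text \<open>Boolean evaluation in which letters and formulas beginning with a modality are all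
  treated as atoms.  A formula true under every such evaluation is a substitution instance of
  a classical propositional tautology, and conversely.\<close>

primrec bool_eval :: "(fm \<Rightarrow> bool) \<Rightarrow> fm \<Rightarrow> bool" where
  "bool_eval v (Var n) \<longleftrightarrow> v (Var n)"
| "bool_eval v Bot \<longleftrightarrow> False"
| "bool_eval v (A \<^bold>\<rightarrow> B) \<longleftrightarrow> (bool_eval v A \<longrightarrow> bool_eval v B)"
| "bool_eval v (Box A) \<longleftrightarrow> v (Box A)"
| "bool_eval v (DBox A) \<longleftrightarrow> v (DBox A)"

definition tautology :: "fm \<Rightarrow> bool" where
  "tautology A \<longleftrightarrow> (\<forall>v. bool_eval v A)"

text \<open>Axioms are stated for fixed letters; the other instances come from closure under
  substitution.\<close>

abbreviation "p \<equiv> Var 0"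
abbreviation "q \<equiv> Var 1"

definition is_logic :: "fm set \<Rightarrow> bool" where
  "is_logic L \<longleftrightarrow>
     (\<forall>A. tautology A \<longrightarrow> A \<in> L) \<and>
     Box (p \<^bold>\<rightarrow> q) \<^bold>\<rightarrow> (Box p \<^bold>\<rightarrow> Box q) \<in> L \<and>
     DBox (p \<^bold>\<rightarrow> q) \<^bold>\<rightarrow> (DBox p \<^bold>\<rightarrow> DBox q) \<in> L \<and>
     (\<forall>\<sigma> A. A \<in> L \<longrightarrow> subst \<sigma> A \<in> L) \<and>
     (\<forall>A B. A \<^bold>\<rightarrow> B \<in> L \<longrightarrow> A \<in> L \<longrightarrow> B \<in> L) \<and>
     (\<forall>A. A \<in> L \<longrightarrow> Box A \<in> L) \<and>
     (\<forall>A. A \<in> L \<longrightarrow> DBox A \<in> L)"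

definition K2 :: "fm set" where
  "K2 = \<Inter> {L. is_logic L}"

definition extend :: "fm set \<Rightarrow> fm set \<Rightarrow> fm set"  (infixl "\<^bold>+" 65) where
  "L \<^bold>+ \<Gamma> = \<Inter> {L'. is_logic L' \<and> L \<subseteq> L' \<and> \<Gamma> \<subseteq> L'}"

definition ax_B_D :: fm where "ax_B_D = p \<^bold>\<rightarrow> DBox (DDia p)"
definition ax_4_D :: fm where "ax_4_D = Conj p (DBox p) \<^bold>\<rightarrow> DBox (DBox p)"
definition ax_D_Box :: fm where "ax_D_Box = UBox p \<^bold>\<rightarrow> Box p"
definition ax_T_Box :: fm where "ax_T_Box = Box p \<^bold>\<rightarrow> p"
definition ax_4_Box :: fm where "ax_4_Box = Box p \<^bold>\<rightarrow> Box (Box p)"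
definition ax_DS :: fm where "ax_DS = DBox p \<^bold>\<rightarrow> Dia p"
definition ax_AT1 :: fm where "ax_AT1 = DBox p \<^bold>\<rightarrow> DBox (Box p)"

definition S4D :: "fm set" where
  "S4D = K2 \<^bold>+ {ax_B_D, ax_4_D, ax_D_Box, ax_T_Box, ax_4_Box}"

definition S4DS :: "fm set" where
  "S4DS = S4D \<^bold>+ {ax_DS}"

definition S4DT1S :: "fm set" where
  "S4DT1S = S4DS \<^bold>+ {ax_AT1}"

record 'w frame =
  worlds :: "'w set"
  acc :: "('w \<times> 'w) set"
  accD :: "('w \<times> 'w) set"

definition kripke_frame :: "'w frame \<Rightarrow> bool" where
  "kripke_frame F \<longleftrightarrow>
     worlds F \<noteq> {} \<and> acc F \<subseteq> worlds F \<times> worlds F \<and> accD F \<subseteq> worlds F \<times> worlds F"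

definition valuation :: "'w frame \<Rightarrow> (nat \<Rightarrow> 'w set) \<Rightarrow> bool" where
  "valuation F \<theta> \<longleftrightarrow> (\<forall>n. \<theta> n \<subseteq> worlds F)"

primrec holds :: "'w frame \<Rightarrow> (nat \<Rightarrow> 'w set) \<Rightarrow> 'w \<Rightarrow> fm \<Rightarrow> bool" where
  "holds F \<theta> x (Var n) \<longleftrightarrow> x \<in> \<theta> n"
| "holds F \<theta> x Bot \<longleftrightarrow> False"
| "holds F \<theta> x (A \<^bold>\<rightarrow> B) \<longleftrightarrow> (holds F \<theta> x A \<longrightarrow> holds F \<theta> x B)"
| "holds F \<theta> x (Box A) \<longleftrightarrow> (\<forall>y. (x, y) \<in> acc F \<longrightarrow> holds F \<theta> y A)"
| "holds F \<theta> x (DBox A) \<longleftrightarrow> (\<forall>y. (x, y) \<in> accD F \<longrightarrow> holds F \<theta> y A)"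

definition valid :: "'w frame \<Rightarrow> fm \<Rightarrow> bool" where
  "valid F A \<longleftrightarrow> (\<forall>\<theta>. valuation F \<theta> \<longrightarrow> (\<forall>x \<in> worlds F. holds F \<theta> x A))"

abbreviation refuted :: "'w frame \<Rightarrow> fm \<Rightarrow> bool" where
  "refuted F A \<equiv> \<not> valid F A"

text \<open>Worlds are natural numbers: every finite frame is isomorphic to one of this form.\<close>

definition finite_model_property :: "fm set \<Rightarrow> bool" where
  "finite_model_property L \<longleftrightarrow>
     (\<forall>A. A \<notin> L \<longrightarrow>
        (\<exists>F :: nat frame. kripke_frame F \<and> finite (worlds F) \<and>
           (\<forall>B \<in> L. valid F B) \<and> refuted F A))"

hide_const (open) p q

end

(* Every formula outside L fails at some maximal L-consistent set x. Restrict the canonical model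
   to the points equal or R_D-related to x: there any two distinct points are R_D-related, so the
   conditions expressed by B_D, 4_D^- and D_Box hold automatically. Filtrate through the subformulas
   of A, using the transitive closure of the minimal filtration for R and the minimal filtration
   for R_D. Distinct classes remain R_D-related, and a class is R_D-irreflexive only if it is a
   singleton {x} with x R_D-irreflexive, which is why the condition of AT_1 survives. *)
theory Submission
  imports Defs
begin

(* The record command generates a fact of the same base name, which shadows the definition of \<^bold>+. *)
hide_fact (open) frame.extend_def

section \<open>Logics and soundness\<close>

lemma is_logic_Inter:
  assumes "\<And>L. L \<in> C \<Longrightarrow> is_logic L"
  shows "is_logic (\<Inter>C)"
  using assms unfolding is_logic_def by (intro conjI; blast)

lemma is_logic_extend: "is_logic (L \<^bold>+ \<Gamma>)"
  unfolding extend_def by (rule is_logic_Inter) blast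

lemma subset_extend: "L \<subseteq> L \<^bold>+ \<Gamma>" "\<Gamma> \<subseteq> L \<^bold>+ \<Gamma>"
  unfolding extend_def by blast+

lemma extend_least:
  assumes "is_logic L'" "L \<subseteq> L'" "\<Gamma> \<subseteq> L'"
  shows "L \<^bold>+ \<Gamma> \<subseteq> L'"
  using assms unfolding extend_def by blast

lemma K2_least: "is_logic L \<Longrightarrow> K2 \<subseteq> L"
  unfolding K2_def by blast

text \<open>Truth at a point is itself one of the evaluations that \<open>tautology\<close>
  quantifies over, so tautologies are valid in every frame.\<close>

lemma holds_bool_eval: "holds F \<theta> x A \<longleftrightarrow> bool_eval (holds F \<theta> x) A"
  by (induction A) auto

text \<open>The new valuation is cut down to \<open>worlds F\<close> so that it counts as a
  \<open>valuation\<close>; this is harmless because the relations never leave the set of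
  worlds.\<close>

lemma holds_subst:
  assumes "kripke_frame F" "x \<in> worlds F"
  shows "holds F \<theta> x (subst \<sigma> A) \<longleftrightarrow> holds F (\<lambda>n. {y \<in> worlds F. holds F \<theta> y (\<sigma> n)}) x A"
  using assms(2)
proof (induction A arbitrary: x)
  case (Box A)
  then show ?case using assms(1) unfolding kripke_frame_def by auto
next
  case (DBox A)
  then show ?case using assms(1) unfolding kripke_frame_def by auto
qed auto

text \<open>By the minimality in \<open>K2\<close> and \<open>extend\<close>, soundness then reduces
  to checking the axioms.\<close>

lemma is_logic_valid:
  assumes F: "kripke_frame F"
  shows "is_logic {A. valid F A}"
proof -
  have "valid F A" if "tautology A" for A
    using that unfolding valid_def tautology_def by (subst holds_bool_eval) blast
  moreover have "valid F (subst \<sigma> A)" if "valid F A" for \<sigma> A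
    using that holds_subst[OF F] unfolding valid_def valuation_def by simp
  moreover have "valid F (Box A)" "valid F (DBox A)" if "valid F A" for A
    using that F unfolding valid_def kripke_frame_def by auto
  moreover have "valid F B" if "valid F (A \<^bold>\<rightarrow> B)" "valid F A" for A B
    using that unfolding valid_def by simp
  moreover have "valid F (Box (A \<^bold>\<rightarrow> B) \<^bold>\<rightarrow> (Box A \<^bold>\<rightarrow> Box B))"
    "valid F (DBox (A \<^bold>\<rightarrow> B) \<^bold>\<rightarrow> (DBox A \<^bold>\<rightarrow> DBox B))" for A B
    unfolding valid_def by simp_all
  ultimately show ?thesis
    unfolding is_logic_def mem_Collect_eq by (intro conjI; blast)
qed

section \<open>Frames whose difference relation relates all distinct points\<close>

text \<open>Here \<open>accD\<close> is inequality together with an arbitrary set of loops.\<close>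

definition diff_frame :: "'w frame \<Rightarrow> bool" where
  "diff_frame F \<longleftrightarrow> kripke_frame F \<and> (\<forall>x \<in> worlds F. (x, x) \<in> acc F) \<and> trans (acc F) \<and>
     (\<forall>x \<in> worlds F. \<forall>y \<in> worlds F. x \<noteq> y \<longrightarrow> (x, y) \<in> accD F)"

text \<open>In a \<open>diff_frame\<close>: every \<open>accD\<close>-irreflexive point has an
  \<open>acc\<close>-successor other than itself.\<close>

definition DS_frame :: "'w frame \<Rightarrow> bool" where
  "DS_frame F \<longleftrightarrow> (\<forall>x \<in> worlds F. \<exists>y. (x, y) \<in> acc F \<and> (x, y) \<in> accD F)"

text \<open>In a \<open>diff_frame\<close> this says that an \<open>accD\<close>-irreflexive point
  has no \<open>acc\<close>-predecessor other than itself.\<close>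

definition T1_frame :: "'w frame \<Rightarrow> bool" where
  "T1_frame F \<longleftrightarrow> (\<forall>x y z. (x, y) \<in> accD F \<longrightarrow> (y, z) \<in> acc F \<longrightarrow> (x, z) \<in> accD F)"

lemma diff_frame_worlds:
  assumes "diff_frame F"
  shows "(x, y) \<in> acc F \<Longrightarrow> x \<in> worlds F" "(x, y) \<in> acc F \<Longrightarrow> y \<in> worlds F"
    "(x, y) \<in> accD F \<Longrightarrow> x \<in> worlds F" "(x, y) \<in> accD F \<Longrightarrow> y \<in> worlds F"
  using assms unfolding diff_frame_def kripke_frame_def by blast+

text \<open>A formula true at a point and at all its \<open>accD\<close>-successors is true
  everywhere, which gives \<open>ax_4_D\<close> and \<open>ax_D_Box\<close>; symmetry of inequality
  gives \<open>ax_B_D\<close>.\<close>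

lemma diff_frame_valid_S4D:
  assumes F: "diff_frame F"
  shows "S4D \<subseteq> {A. valid F A}"
proof -
  note w = diff_frame_worlds[OF F]
  have refl: "(x, x) \<in> acc F" if "x \<in> worlds F" for x
    using F that unfolding diff_frame_def by blast
  have tot: "x = y \<or> (x, y) \<in> accD F" if "x \<in> worlds F" "y \<in> worlds F" for x y
    using F that unfolding diff_frame_def by blast
  have "is_logic {A. valid F A}"
    using F is_logic_valid unfolding diff_frame_def by blast
  moreover have "valid F ax_B_D"
    unfolding valid_def ax_B_D_def using w tot by simp metis
  moreover have "valid F ax_4_D"
    unfolding valid_def ax_4_D_def using w tot by simp metis
  moreover have "valid F ax_D_Box"
    unfolding valid_def ax_D_Box_def using w tot by simp metis
  moreover have "valid F ax_T_Box"
    unfolding valid_def ax_T_Box_def using refl by simp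
  moreover have "valid F ax_4_Box"
    unfolding valid_def ax_4_Box_def using F unfolding diff_frame_def by simp (meson transD)
  ultimately show ?thesis
    unfolding S4D_def by (intro extend_least K2_least) auto
qed

lemma diff_frame_valid_S4DS:
  assumes "diff_frame F" "DS_frame F"
  shows "S4DS \<subseteq> {A. valid F A}"
proof -
  have "valid F ax_DS"
    using assms(2) unfolding DS_frame_def valid_def ax_DS_def by simp blast
  then show ?thesis
    using assms(1) diff_frame_valid_S4D[OF assms(1)] is_logic_valid
    unfolding S4DS_def diff_frame_def by (intro extend_least) auto
qed

lemma diff_frame_valid_S4DT1S:
  assumes "diff_frame F" "DS_frame F" "T1_frame F"
  shows "S4DT1S \<subseteq> {A. valid F A}"
proof -
  have "valid F ax_AT1"
    using assms(3) unfolding T1_frame_def valid_def ax_AT1_def by auto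
  then show ?thesis
    using assms(1) diff_frame_valid_S4DS[OF assms(1,2)] is_logic_valid
    unfolding S4DT1S_def diff_frame_def by (intro extend_least) auto
qed

section \<open>Filtration\<close>

text \<open>Classes are represented by values of \<open>f\<close>, so the worlds of the filtration
  can be natural numbers.\<close>

definition filtrate :: "('w \<Rightarrow> 'v) \<Rightarrow> 'w frame \<Rightarrow> 'v frame" where
  "filtrate f F = \<lparr>worlds = f ` worlds F, acc = (map_prod f f ` acc F)\<^sup>+,
     accD = map_prod f f ` accD F\<rparr>"

text \<open>Distinct classes have distinct representatives, which are already
  \<open>accD\<close>-related; transitivity comes from the closure.\<close>

lemma diff_frame_filtrate:
  assumes F: "diff_frame F"
  shows "diff_frame (filtrate f F)"
proof -
  have "acc F \<subseteq> worlds F \<times> worlds F" "accD F \<subseteq> worlds F \<times> worlds F" "worlds F \<noteq> {}"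
    using F unfolding diff_frame_def kripke_frame_def by auto
  then have "map_prod f f ` acc F \<subseteq> f ` worlds F \<times> f ` worlds F"
    "map_prod f f ` accD F \<subseteq> f ` worlds F \<times> f ` worlds F"
    by auto
  then have "kripke_frame (filtrate f F)"
    using \<open>worlds F \<noteq> {}\<close> trancl_subset_Sigma
    unfolding kripke_frame_def filtrate_def by simp
  moreover have "(x, x) \<in> acc (filtrate f F)" if "x \<in> worlds (filtrate f F)" for x
    using that F unfolding diff_frame_def filtrate_def by force
  moreover have "(x, y) \<in> accD (filtrate f F)"
    if "x \<in> worlds (filtrate f F)" "y \<in> worlds (filtrate f F)" "x \<noteq> y" for x y
    using that F unfolding diff_frame_def filtrate_def by force
  ultimately show ?thesis
    unfolding diff_frame_def by (simp add: filtrate_def)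
qed

lemma DS_frame_filtrate:
  assumes "DS_frame F"
  shows "DS_frame (filtrate f F)"
  unfolding DS_frame_def
proof
  fix X assume "X \<in> worlds (filtrate f F)"
  then obtain x where "x \<in> worlds F" "X = f x"
    unfolding filtrate_def by auto
  then obtain y where "(x, y) \<in> acc F" "(x, y) \<in> accD F"
    using assms unfolding DS_frame_def by blast
  then show "\<exists>Y. (X, Y) \<in> acc (filtrate f F) \<and> (X, Y) \<in> accD (filtrate f F)"
    unfolding filtrate_def \<open>X = f x\<close> by (auto intro!: exI[of _ "f y"])
qed

lemma T1_frame_filtrate:
  assumes F: "diff_frame F" and T1: "T1_frame F"
  shows "T1_frame (filtrate f F)"
proof -
  note w = diff_frame_worlds[OF F]
  have tot: "x = y \<or> (x, y) \<in> accD F" if "x \<in> worlds F" "y \<in> worlds F" for x y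
    using F that unfolding diff_frame_def by blast
  \<comment> \<open>One step of the minimal filtration suffices; induction along the closure does
    the rest. The two pairs may use different representatives \<open>y\<close> and \<open>y'\<close>
    of the class \<open>Y\<close>.\<close>
  have accD_step: "(X, Z) \<in> map_prod f f ` accD F"
    if XY: "(X, Y) \<in> map_prod f f ` accD F" and YZ: "(Y, Z) \<in> map_prod f f ` acc F" for X Y Z
  proof -
    obtain x y where X: "X = f x" and "Y = f y" and D: "(x, y) \<in> accD F" using XY by auto
    moreover obtain y' z where "Y = f y'" and Z: "Z = f z" and A: "(y', z) \<in> acc F" using YZ by auto
    ultimately have "f y = f y'" by simp
    consider "x \<noteq> z" | "x = z" "y' = z" | "x = z" "y' \<noteq> z" by blast
    then have "(f x, f z) \<in> map_prod f f ` accD F"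
    proof cases
      case 1
      then have "(x, z) \<in> accD F" using tot w D A by blast
      then show ?thesis by force
    next
      case 2
      then show ?thesis using D \<open>f y = f y'\<close> by force
    next
      \<comment> \<open>Now \<open>z\<close> has a proper \<open>acc\<close>-predecessor
        \<open>y'\<close>, so the T1 condition forces an \<open>accD\<close>-loop at
        \<open>z\<close>, and that loop is the required pair.\<close>
      case 3
      then have "(z, y') \<in> accD F" using tot w A by metis
      then have "(z, z) \<in> accD F" using T1 A unfolding T1_frame_def by blast
      with 3 show ?thesis by force
    qed
    then show ?thesis using X Z by simp
  qed
  have "(X, Z) \<in> map_prod f f ` accD F"
    if "(Y, Z) \<in> (map_prod f f ` acc F)\<^sup>+" "(X, Y) \<in> map_prod f f ` accD F" for X Y Z
    using that
  proof (induction rule: trancl_induct)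
    case (base Z)
    then show ?case using accD_step by metis
  next
    case (step Y' Z)
    then show ?case using accD_step by metis
  qed
  then show ?thesis
    unfolding T1_frame_def filtrate_def by auto
qed

section \<open>Truth in the filtration and finite refutations\<close>

primrec subfms :: "fm \<Rightarrow> fm set" where
  "subfms (Var n) = {Var n}"
| "subfms Bot = {Bot}"
| "subfms (A \<^bold>\<rightarrow> B) = insert (A \<^bold>\<rightarrow> B) (subfms A \<union> subfms B)"
| "subfms (Box A) = insert (Box A) (subfms A)"
| "subfms (DBox A) = insert (DBox A) (subfms A)"

lemma finite_subfms: "finite (subfms A)"
  by (induction A) auto

lemma holds_filtrate:
  assumes F: "diff_frame F" and \<theta>: "valuation F \<theta>"
    and f: "\<And>x y B. x \<in> worlds F \<Longrightarrow> y \<in> worlds F \<Longrightarrow> f x = f y \<Longrightarrow> B \<in> \<Sigma> \<Longrightarrow>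
      holds F \<theta> x B \<longleftrightarrow> holds F \<theta> y B"
    and "subfms A \<subseteq> \<Sigma>" "x \<in> worlds F"
  shows "holds (filtrate f F) (\<lambda>n. f ` \<theta> n) (f x) A \<longleftrightarrow> holds F \<theta> x A"
  using assms(4,5)
proof (induction A arbitrary: x)
  case (Var n)
  \<comment> \<open>Letters in \<open>\<Sigma>\<close> are constant on classes, so passing to the
    image of \<open>\<theta>\<close> makes no further points satisfy them.\<close>
  have "x \<in> \<theta> n" if "y \<in> \<theta> n" "f x = f y" for y
    using f[of x y "Var n"] that Var \<theta> unfolding valuation_def by auto
  then show ?case by auto
next
  case (Box A)
  note w = diff_frame_worlds[OF F]
  have sub: "Box A \<in> \<Sigma>" "subfms A \<subseteq> \<Sigma>" using Box.prems by auto
  \<comment> \<open>Along a chain in the closure it is \<open>Box A\<close>, not just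
    \<open>A\<close>, that is propagated: agreement on \<open>\<Sigma>\<close> moves it between
    representatives, transitivity moves it across a step, and reflexivity yields \<open>A\<close> at
    the end.\<close>
  have "\<exists>y \<in> worlds F. Y = f y \<and> holds F \<theta> y (Box A)"
    if "(f x, Y) \<in> (map_prod f f ` acc F)\<^sup>+" "holds F \<theta> x (Box A)" for Y
    using that(1)
  proof (induction rule: trancl_induct)
    case (base Y)
    then obtain a b where ab: "f x = f a" "Y = f b" "(a, b) \<in> acc F" by auto
    then have "holds F \<theta> a (Box A)" using f[of x a] that(2) Box.prems w sub by blast
    then have "holds F \<theta> b (Box A)" using ab(3) F unfolding diff_frame_def by simp (meson transD)
    then show ?case using ab w by blast
  next
    case (step Y Z)
    then obtain y where y: "y \<in> worlds F" "Y = f y" "holds F \<theta> y (Box A)" by blast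
    with step.hyps(2) obtain a b where "f y = f a" "Z = f b" "(a, b) \<in> acc F" by auto
    note ab = y(1,3) this
    then have "holds F \<theta> a (Box A)" using f[of y a] w sub by blast
    then have "holds F \<theta> b (Box A)" using ab(5) F unfolding diff_frame_def by simp (meson transD)
    then show ?case using ab w by blast
  qed
  moreover have "holds F \<theta> y A" if "holds F \<theta> y (Box A)" "y \<in> worlds F" for y
    using that F unfolding diff_frame_def by simp
  ultimately have "holds (filtrate f F) (\<lambda>n. f ` \<theta> n) Y A"
    if "(f x, Y) \<in> acc (filtrate f F)" "holds F \<theta> x (Box A)" for Y
    using that Box.IH[OF sub(2)] by (metis filtrate_def frame.select_convs(2))
  then have "holds (filtrate f F) (\<lambda>n. f ` \<theta> n) (f x) (Box A)" if "holds F \<theta> x (Box A)"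
    using that by simp
  moreover have "holds F \<theta> x (Box A)" if "holds (filtrate f F) (\<lambda>n. f ` \<theta> n) (f x) (Box A)"
  proof -
    have "holds F \<theta> y A" if xy: "(x, y) \<in> acc F" for y
    proof -
      have "(f x, f y) \<in> acc (filtrate f F)" using xy unfolding filtrate_def by force
      then show ?thesis
        using \<open>holds (filtrate f F) _ (f x) (Box A)\<close> Box.IH[OF sub(2)] w xy by auto
    qed
    then show ?thesis by simp
  qed
  ultimately show ?case by blast
next
  case (DBox A)
  note w = diff_frame_worlds[OF F]
  have sub: "DBox A \<in> \<Sigma>" "subfms A \<subseteq> \<Sigma>" using DBox.prems by auto
  have "holds (filtrate f F) (\<lambda>n. f ` \<theta> n) Y A"
    if xY: "(f x, Y) \<in> accD (filtrate f F)" and box: "holds F \<theta> x (DBox A)" for Y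
  proof -
    obtain a b where ab: "f x = f a" "Y = f b" "(a, b) \<in> accD F"
      using xY unfolding filtrate_def by auto
    then have "holds F \<theta> a (DBox A)" using f[of x a] box DBox.prems w sub by blast
    then show ?thesis using ab w DBox.IH[OF sub(2)] by auto
  qed
  moreover have "holds F \<theta> y A"
    if "(x, y) \<in> accD F" "holds (filtrate f F) (\<lambda>n. f ` \<theta> n) (f x) (DBox A)" for y
  proof -
    have "(f x, f y) \<in> accD (filtrate f F)" using that(1) unfolding filtrate_def by force
    then show ?thesis using that DBox.IH[OF sub(2)] w by auto
  qed
  ultimately show ?case by auto
qed auto

lemma finite_refutation:
  fixes F :: "'w frame"
  assumes F: "diff_frame F" and "refuted F A"
  obtains G :: "nat frame" where "diff_frame G" "finite (worlds G)" "refuted G A"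
    "DS_frame F \<longrightarrow> DS_frame G" "T1_frame F \<longrightarrow> T1_frame G"
proof -
  obtain \<theta> x where \<theta>: "valuation F \<theta>" and x: "x \<in> worlds F" "\<not> holds F \<theta> x A"
    using assms(2) unfolding valid_def by blast
  obtain g :: "fm set \<Rightarrow> nat" where g: "inj_on g (Pow (subfms A))"
    using finite_imp_inj_to_nat_seg[of "Pow (subfms A)"] finite_subfms by auto
  \<comment> \<open>Each world is sent to the numerical code of the set of subformulas of
    \<open>A\<close> true there. Equal codes mean agreement on all of them, and there are only
    finitely many codes.\<close>
  define f where "f x = g {B \<in> subfms A. holds F \<theta> x B}" for x
  have f: "holds F \<theta> x B \<longleftrightarrow> holds F \<theta> y B" if "f x = f y" "B \<in> subfms A" for x y B
    using inj_onD[OF g that(1)[unfolded f_def]] that(2) by auto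
  have "\<not> holds (filtrate f F) (\<lambda>n. f ` \<theta> n) (f x) A"
    using holds_filtrate[where \<Sigma> = "subfms A", OF F \<theta>] f x by blast
  moreover have "valuation (filtrate f F) (\<lambda>n. f ` \<theta> n)"
    using \<theta> unfolding valuation_def filtrate_def by auto
  ultimately have "refuted (filtrate f F) A"
    using x(1) unfolding valid_def by (auto simp: filtrate_def)
  moreover have "f ` worlds F \<subseteq> g ` Pow (subfms A)"
    unfolding f_def by auto
  then have "finite (worlds (filtrate f F))"
    by (simp add: filtrate_def finite_subfms finite_subset)
  ultimately show thesis
    using that diff_frame_filtrate[OF F] DS_frame_filtrate T1_frame_filtrate[OF F] by blast
qed

section \<open>The canonical model\<close>

locale bimodal_logic =
  fixes L :: "fm set"
  assumes is_logic: "is_logic L"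
begin

lemma taut: "tautology A \<Longrightarrow> A \<in> L"
  using is_logic unfolding is_logic_def by blast

lemma substitution: "A \<in> L \<Longrightarrow> subst \<sigma> A \<in> L"
  using is_logic unfolding is_logic_def by blast

text \<open>Premises may be combined by modus ponens only; leaving out generalization is what makes
  the deduction theorem hold.\<close>

inductive derivable :: "fm set \<Rightarrow> fm \<Rightarrow> bool"  (infix "\<turnstile>" 50) for \<Gamma> where
  ax: "A \<in> L \<Longrightarrow> \<Gamma> \<turnstile> A"
| prem: "A \<in> \<Gamma> \<Longrightarrow> \<Gamma> \<turnstile> A"
| mp: "\<Gamma> \<turnstile> A \<^bold>\<rightarrow> B \<Longrightarrow> \<Gamma> \<turnstile> A \<Longrightarrow> \<Gamma> \<turnstile> B"

lemma derivable_mono: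
  assumes "\<Gamma> \<turnstile> A" "\<Gamma> \<subseteq> \<Delta>"
  shows "\<Delta> \<turnstile> A"
  using assms by induction (auto intro: derivable.intros)

lemma derivable_empty:
  assumes "{} \<turnstile> A"
  shows "A \<in> L"
  using assms by induction (use is_logic in \<open>auto simp: is_logic_def\<close>)

lemma deduction:
  assumes "insert A \<Gamma> \<turnstile> B"
  shows "\<Gamma> \<turnstile> A \<^bold>\<rightarrow> B"
  using assms
proof induction
  case (ax B)
  have "B \<^bold>\<rightarrow> (A \<^bold>\<rightarrow> B) \<in> L" by (rule taut) (simp add: tautology_def)
  then show ?case using ax derivable.intros by metis
next
  case (prem B)
  have "B \<^bold>\<rightarrow> (A \<^bold>\<rightarrow> B) \<in> L" "A \<^bold>\<rightarrow> A \<in> L" by (auto intro!: taut simp: tautology_def)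
  then show ?case using prem derivable.intros by (metis insertE)
next
  case (mp B C)
  have "(A \<^bold>\<rightarrow> (B \<^bold>\<rightarrow> C)) \<^bold>\<rightarrow> ((A \<^bold>\<rightarrow> B) \<^bold>\<rightarrow> (A \<^bold>\<rightarrow> C)) \<in> L"
    by (rule taut) (simp add: tautology_def)
  then show ?case using mp.IH derivable.intros by metis
qed

text \<open>Finiteness of derivations: at each use of modus ponens the larger of two chain members
  serves both premises.\<close>

lemma derivable_chain_Union:
  assumes "\<Union>C \<turnstile> A" "C \<noteq> {}" "\<And>X Y. X \<in> C \<Longrightarrow> Y \<in> C \<Longrightarrow> X \<subseteq> Y \<or> Y \<subseteq> X"
  shows "\<exists>X \<in> C. X \<turnstile> A"
  using assms(1)
proof induction
  case (mp A B)
  then obtain X Y where "X \<in> C" "Y \<in> C" "X \<turnstile> A \<^bold>\<rightarrow> B" "Y \<turnstile> A" by blast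
  then show ?case using assms(3)[of X Y] derivable_mono derivable.mp by metis
qed (use assms(2) derivable.intros in blast)+

definition mcs :: "fm set \<Rightarrow> bool" where
  "mcs x \<longleftrightarrow> \<not> x \<turnstile> Bot \<and> (\<forall>A. A \<in> x \<or> Neg A \<in> x)"

lemma lindenbaum:
  assumes "\<not> \<Gamma> \<turnstile> Bot"
  obtains x where "mcs x" "\<Gamma> \<subseteq> x"
proof -
  let ?S = "{X. \<Gamma> \<subseteq> X \<and> \<not> X \<turnstile> Bot}"
  have "\<exists>M \<in> ?S. \<forall>X \<in> ?S. M \<subseteq> X \<longrightarrow> X = M"
  proof (rule subset_Zorn_nonempty)
    show "?S \<noteq> {}" using assms by blast
    fix C assume "C \<noteq> {}" and C: "subset.chain ?S C"
    have "\<not> \<Union>C \<turnstile> Bot"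
    proof
      assume "\<Union>C \<turnstile> Bot"
      then have "\<exists>X \<in> C. X \<turnstile> Bot"
        by (rule derivable_chain_Union) (use \<open>C \<noteq> {}\<close> C in \<open>auto simp: subset_chain_def\<close>)
      then show False using C unfolding subset_chain_def by blast
    qed
    then show "\<Union>C \<in> ?S"
      using \<open>C \<noteq> {}\<close> C unfolding subset_chain_def by blast
  qed
  then obtain x where "x \<in> ?S" and max: "\<forall>X \<in> ?S. x \<subseteq> X \<longrightarrow> X = x" ..
  then have x: "\<Gamma> \<subseteq> x" "\<not> x \<turnstile> Bot" by auto
  have "A \<in> x \<or> Neg A \<in> x" for A
  proof (rule ccontr)
    assume "\<not> ?thesis"
    \<comment> \<open>By maximality both proper extensions are inconsistent, so \<open>x\<close>
      would derive \<open>Neg A\<close> and \<open>Neg (Neg A)\<close>.\<close>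
    then have "insert A x \<turnstile> Bot" "insert (Neg A) x \<turnstile> Bot"
      using max[THEN bspec, of "insert A x"] max[THEN bspec, of "insert (Neg A) x"] x(1) by auto
    then show False using deduction x(2) derivable.mp by metis
  qed
  then show thesis using that x unfolding mcs_def by blast
qed

lemma mcs_derivable: "mcs x \<Longrightarrow> x \<turnstile> A \<Longrightarrow> A \<in> x"
  unfolding mcs_def using derivable.intros by metis

lemma mcs_thm: "mcs x \<Longrightarrow> A \<in> L \<Longrightarrow> A \<in> x"
  using mcs_derivable derivable.ax by blast

lemma mcs_Bot: "mcs x \<Longrightarrow> Bot \<notin> x"
  unfolding mcs_def using derivable.prem by blast

lemma mcs_mp: "mcs x \<Longrightarrow> A \<^bold>\<rightarrow> B \<in> x \<Longrightarrow> A \<in> x \<Longrightarrow> B \<in> x"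
  using mcs_derivable derivable.intros by metis

lemma mcs_Imp: "mcs x \<Longrightarrow> A \<^bold>\<rightarrow> B \<in> x \<longleftrightarrow> (A \<in> x \<longrightarrow> B \<in> x)"
proof
  assume x: "mcs x" and AB: "A \<in> x \<longrightarrow> B \<in> x"
  have "Neg A \<^bold>\<rightarrow> (A \<^bold>\<rightarrow> B) \<in> L" "B \<^bold>\<rightarrow> (A \<^bold>\<rightarrow> B) \<in> L"
    by (auto intro!: taut simp: tautology_def)
  then show "A \<^bold>\<rightarrow> B \<in> x"
    using AB x mcs_mp mcs_thm unfolding mcs_def by metis
qed (use mcs_mp in blast)

text \<open>The modality is a parameter so that \<open>Box\<close> and \<open>DBox\<close> share one
  existence argument.\<close>

definition can_rel :: "(fm \<Rightarrow> fm) \<Rightarrow> fm set \<Rightarrow> fm set \<Rightarrow> bool" where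
  "can_rel M x y \<longleftrightarrow> mcs x \<and> mcs y \<and> (\<forall>A. M A \<in> x \<longrightarrow> A \<in> y)"

lemma modality:
  assumes "M \<in> {Box, DBox}"
  shows "A \<in> L \<Longrightarrow> M A \<in> L" "M (A \<^bold>\<rightarrow> B) \<^bold>\<rightarrow> (M A \<^bold>\<rightarrow> M B) \<in> L"
proof -
  show "A \<in> L \<Longrightarrow> M A \<in> L"
    using assms is_logic unfolding is_logic_def by blast
  have "Box (Var 0 \<^bold>\<rightarrow> Var 1) \<^bold>\<rightarrow> (Box (Var 0) \<^bold>\<rightarrow> Box (Var 1)) \<in> L"
    "DBox (Var 0 \<^bold>\<rightarrow> Var 1) \<^bold>\<rightarrow> (DBox (Var 0) \<^bold>\<rightarrow> DBox (Var 1)) \<in> L"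
    using is_logic unfolding is_logic_def by blast+
  from this[THEN substitution[where \<sigma> = "\<lambda>n. if n = 0 then A else B"]]
  show "M (A \<^bold>\<rightarrow> B) \<^bold>\<rightarrow> (M A \<^bold>\<rightarrow> M B) \<in> L"
    using assms by auto
qed

lemma modality_mcs_mp:
  assumes "M \<in> {Box, DBox}" "mcs x" "M (A \<^bold>\<rightarrow> B) \<in> x" "M A \<in> x"
  shows "M B \<in> x"
  using assms modality(2) mcs_thm mcs_mp by metis

text \<open>Normality: a derivation from the unboxed formulas can be carried out under the modality
  inside \<open>x\<close>.\<close>

lemma modality_derivable:
  assumes M: "M \<in> {Box, DBox}" and x: "mcs x" and "{B. M B \<in> x} \<turnstile> A"
  shows "M A \<in> x"
  using assms(3)
proof induction
  case (ax A)
  then show ?case using modality(1)[OF M] mcs_thm[OF x] by blast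
next
  case (mp A B)
  then show ?case using modality_mcs_mp[OF M x] by blast
qed simp

text \<open>If \<open>A\<close> lies in every successor, then \<open>Neg A\<close> is inconsistent
  with the unboxed formulas of \<open>x\<close>, since a Lindenbaum extension of them would be a
  successor omitting \<open>A\<close>.\<close>

lemma modality_iff:
  assumes M: "M \<in> {Box, DBox}" and x: "mcs x"
  shows "M A \<in> x \<longleftrightarrow> (\<forall>y. can_rel M x y \<longrightarrow> A \<in> y)"
proof
  assume all: "\<forall>y. can_rel M x y \<longrightarrow> A \<in> y"
  have "insert (Neg A) {B. M B \<in> x} \<turnstile> Bot"
  proof (rule ccontr)
    assume "\<not> ?thesis"
    then obtain y where y: "mcs y" "insert (Neg A) {B. M B \<in> x} \<subseteq> y" by (rule lindenbaum)
    then have "A \<in> y" using all x unfolding can_rel_def by blast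
    then show False using y mcs_mp mcs_Bot by blast
  qed
  then have "{B. M B \<in> x} \<turnstile> Neg (Neg A)" by (rule deduction)
  moreover have "Neg (Neg A) \<^bold>\<rightarrow> A \<in> L" by (rule taut) (simp add: tautology_def)
  ultimately have "{B. M B \<in> x} \<turnstile> A" using derivable.intros by metis
  then show "M A \<in> x" by (rule modality_derivable[OF M x])
qed (auto simp: can_rel_def)

lemmas Box_iff = modality_iff[of Box, simplified]
lemmas DBox_iff = modality_iff[of DBox, simplified]
text \<open>Rewriting with these replaces modal derivations in \<open>L\<close> by first-order
  reasoning about canonical points.\<close>

lemmas mcs_iffs = mcs_Imp mcs_Bot Box_iff DBox_iff

lemma can_rel_mcs: "can_rel M x y \<Longrightarrow> mcs x" "can_rel M x y \<Longrightarrow> mcs y"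
  unfolding can_rel_def by auto

text \<open>A common successor has to contain the unboxed formulas of both modalities, so their
  union must be shown consistent.\<close>

lemma can_DS:
  assumes DS: "ax_DS \<in> L" and x: "mcs x"
  shows "\<exists>y. can_rel Box x y \<and> can_rel DBox x y"
proof -
  let ?\<Gamma> = "{B. Box B \<in> x} \<union> {B. DBox B \<in> x}"
  \<comment> \<open>The \<open>DBox\<close> premises of a derivation are gathered into a single
    \<open>C\<close>. For \<open>A = Bot\<close> this would give \<open>Box (Neg C)\<close>, against
    the \<open>Dia C\<close> supplied by \<open>ax_DS\<close>.\<close>
  have "\<exists>C. DBox C \<in> x \<and> Box (C \<^bold>\<rightarrow> A) \<in> x" if "?\<Gamma> \<turnstile> A" for A
    using that
  proof induction
    case (ax A)
    then have "Box A \<in> x" using modality(1)[of Box] mcs_thm[OF x] by blast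
    then show ?case
      \<comment> \<open>No \<open>DBox\<close> premise is involved here, so verum serves as
        \<open>C\<close>.\<close>
      by (intro exI[of _ "Neg Bot"]) (use x can_rel_mcs in \<open>simp add: mcs_iffs\<close>)
  next
    case (prem A)
    show ?case
    proof (cases "DBox A \<in> x")
      case True
      then show ?thesis
        by (intro exI[of _ A]) (use x can_rel_mcs in \<open>simp add: mcs_iffs\<close>)
    next
      case False
      then have "Box A \<in> x" using prem by blast
      then show ?thesis
        by (intro exI[of _ "Neg Bot"]) (use x can_rel_mcs in \<open>simp add: mcs_iffs\<close>)
    qed
  next
    case (mp A B)
    then obtain C D where "DBox C \<in> x" "Box (C \<^bold>\<rightarrow> (A \<^bold>\<rightarrow> B)) \<in> x" "DBox D \<in> x" "Box (D \<^bold>\<rightarrow> A) \<in> x"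
      by blast
    then show ?case
      by (intro exI[of _ "Conj C D"]) (use x can_rel_mcs in \<open>simp add: mcs_iffs\<close>)
  qed
  moreover have "DBox C \<^bold>\<rightarrow> Dia C \<in> L" for C
    using substitution[OF DS, of "\<lambda>_. C"] unfolding ax_DS_def by simp
  then have "Dia C \<in> x" if "DBox C \<in> x" for C
    using that x mcs_thm mcs_mp by blast
  then have "Box (Neg C) \<notin> x" if "DBox C \<in> x" for C
    using that x mcs_mp mcs_Bot by blast
  ultimately have "\<not> ?\<Gamma> \<turnstile> Bot" by blast
  then obtain y where "mcs y" "?\<Gamma> \<subseteq> y" by (rule lindenbaum)
  then show ?thesis using x unfolding can_rel_def by blast
qed

lemma can_T1:
  assumes AT1: "ax_AT1 \<in> L" and "can_rel DBox x y" "can_rel Box y z"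
  shows "can_rel DBox x z"
proof -
  have "DBox C \<^bold>\<rightarrow> DBox (Box C) \<in> L" for C
    using substitution[OF AT1, of "\<lambda>_. C"] unfolding ax_AT1_def by simp
  then show ?thesis
    using assms(2,3) mcs_thm mcs_mp unfolding can_rel_def by blast
qed

end

section \<open>Canonical relations of logics containing S4D\<close>

locale S4D_logic = bimodal_logic +
  assumes S4D_axioms: "{ax_B_D, ax_4_D, ax_D_Box, ax_T_Box, ax_4_Box} \<subseteq> L"
begin

lemma instances:
  "C \<^bold>\<rightarrow> DBox (DDia C) \<in> L" "Conj C (DBox C) \<^bold>\<rightarrow> DBox (DBox C) \<in> L" "UBox C \<^bold>\<rightarrow> Box C \<in> L"
  "Box C \<^bold>\<rightarrow> C \<in> L" "Box C \<^bold>\<rightarrow> Box (Box C) \<in> L"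
proof -
  have "ax_B_D \<in> L" "ax_4_D \<in> L" "ax_D_Box \<in> L" "ax_T_Box \<in> L" "ax_4_Box \<in> L"
    using S4D_axioms by auto
  from this[THEN substitution[where \<sigma> = "\<lambda>_. C"]]
  show "C \<^bold>\<rightarrow> DBox (DDia C) \<in> L" "Conj C (DBox C) \<^bold>\<rightarrow> DBox (DBox C) \<in> L" "UBox C \<^bold>\<rightarrow> Box C \<in> L"
    "Box C \<^bold>\<rightarrow> C \<in> L" "Box C \<^bold>\<rightarrow> Box (Box C) \<in> L"
    unfolding ax_B_D_def ax_4_D_def ax_D_Box_def ax_T_Box_def ax_4_Box_def by simp_all
qed

lemma can_refl: "mcs x \<Longrightarrow> can_rel Box x x"
  unfolding can_rel_def using instances(4) mcs_thm mcs_mp by blast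

lemma can_trans: "can_rel Box x y \<Longrightarrow> can_rel Box y z \<Longrightarrow> can_rel Box x z"
  unfolding can_rel_def using instances(5) mcs_thm mcs_mp by blast

text \<open>If \<open>DBox C\<close> is in \<open>y\<close> but \<open>C\<close> is not in
  \<open>x\<close>, then \<open>ax_B_D\<close> for \<open>Neg C\<close> puts
  \<open>DDia (Neg C)\<close> into \<open>y\<close>, a contradiction.\<close>

lemma can_sym:
  assumes "can_rel DBox x y"
  shows "can_rel DBox y x"
proof -
  note m = can_rel_mcs[OF assms]
  have "C \<in> x" if "DBox C \<in> y" for C
  proof (rule ccontr)
    assume "C \<notin> x"
    then have "Neg C \<in> x" using m by (simp add: mcs_Imp)
    then have "DBox (DDia (Neg C)) \<in> x" using instances(1) m mcs_thm mcs_mp by blast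
    then have "DDia (Neg C) \<in> y" using assms unfolding can_rel_def by blast
    then show False using that m can_rel_mcs by (auto simp: mcs_iffs)
  qed
  then show ?thesis using m unfolding can_rel_def by blast
qed

text \<open>\<open>D\<close> is the disjunction of a \<open>B\<close> with \<open>DBox B \<in> x\<close>, \<open>B \<notin> z\<close> and a \<open>C\<close> separating \<open>x\<close> from \<open>z\<close>.\<close>

lemma not_can_rel_DBox:
  assumes "mcs x" "mcs z" "x \<noteq> z" "\<not> can_rel DBox x z"
  obtains D where "D \<in> x" "DBox D \<in> x" "D \<notin> z"
proof -
  obtain B where B: "DBox B \<in> x" "B \<notin> z" using assms unfolding can_rel_def by blast
  obtain C where C: "C \<in> x" "C \<notin> z"
  proof (cases "x \<subseteq> z")
    case True
    \<comment> \<open>A formula of \<open>z\<close> missing from \<open>x\<close> separates in the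
      wrong direction; its negation separates in the right one.\<close>
    then obtain E where "E \<in> z" "E \<notin> x" using assms by blast
    then have "Neg E \<in> x" "Neg E \<notin> z" using assms by (auto simp: mcs_iffs)
    then show thesis using that by blast
  qed (use that in blast)
  have "Neg B \<^bold>\<rightarrow> C \<in> x" "DBox (Neg B \<^bold>\<rightarrow> C) \<in> x" "Neg B \<^bold>\<rightarrow> C \<notin> z"
    using B C assms can_rel_mcs by (auto simp: mcs_iffs)
  then show thesis using that by blast
qed

text \<open>Otherwise the separating \<open>D\<close> meets the premise of \<open>ax_4_D\<close> at
  \<open>x\<close>, and \<open>DBox (DBox D)\<close> carries it over two steps to
  \<open>z\<close>.\<close>

lemma can_pseudotrans:
  assumes "can_rel DBox x y" "can_rel DBox y z" "x \<noteq> z"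
  shows "can_rel DBox x z"
proof (rule ccontr)
  note m = can_rel_mcs[OF assms(1)] can_rel_mcs[OF assms(2)]
  assume "\<not> ?thesis"
  then obtain D where D: "D \<in> x" "DBox D \<in> x" "D \<notin> z"
    using not_can_rel_DBox m assms(3) by blast
  then have "Conj D (DBox D) \<in> x" using m by (simp add: mcs_Imp mcs_Bot)
  then have "DBox (DBox D) \<in> x" using instances(2) m mcs_thm mcs_mp by blast
  then show False using assms D unfolding can_rel_def by blast
qed

text \<open>The same separating formula, now carried by \<open>ax_D_Box\<close> over one
  \<open>Box\<close> step.\<close>

lemma can_Box_DBox:
  assumes "can_rel Box x y" "x \<noteq> y"
  shows "can_rel DBox x y"
proof (rule ccontr)
  note m = can_rel_mcs[OF assms(1)]
  assume "\<not> ?thesis"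
  then obtain D where D: "D \<in> x" "DBox D \<in> x" "D \<notin> y"
    using not_can_rel_DBox m assms(2) by blast
  then have "UBox D \<in> x" using m by (simp add: mcs_Imp mcs_Bot)
  then have "Box D \<in> x" using instances(3) m mcs_thm mcs_mp by blast
  then show False using assms D unfolding can_rel_def by blast
qed

section \<open>The canonical model restricted to a point and its R_D-successors\<close>

definition cluster :: "fm set \<Rightarrow> fm set set" where
  "cluster x = insert x {y. can_rel DBox x y}"

definition can_frame :: "fm set \<Rightarrow> fm set frame" where
  "can_frame x = \<lparr>worlds = cluster x,
     acc = {(y, z). y \<in> cluster x \<and> z \<in> cluster x \<and> can_rel Box y z},
     accD = {(y, z). y \<in> cluster x \<and> z \<in> cluster x \<and> can_rel DBox y z}\<rparr>"

lemma mcs_cluster: "mcs x \<Longrightarrow> y \<in> cluster x \<Longrightarrow> mcs y"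
  unfolding cluster_def using can_rel_mcs by blast

text \<open>Pseudo-transitivity leaves out only the return to \<open>x\<close>, which is in the
  cluster by definition. Closure under both relations lets the truth lemma survive the
  restriction.\<close>

lemma cluster_DBox: "y \<in> cluster x \<Longrightarrow> can_rel DBox y z \<Longrightarrow> z \<in> cluster x"
  unfolding cluster_def using can_pseudotrans by blast

lemma cluster_Box: "y \<in> cluster x \<Longrightarrow> can_rel Box y z \<Longrightarrow> z \<in> cluster x"
  using cluster_DBox can_Box_DBox by metis

lemma diff_frame_can_frame:
  assumes x: "mcs x"
  shows "diff_frame (can_frame x)"
proof -
  \<comment> \<open>Points other than \<open>x\<close> are linked through \<open>x\<close>, by
    symmetry and pseudo-transitivity.\<close>
  have "can_rel DBox y z" if "y \<in> cluster x" "z \<in> cluster x" "y \<noteq> z" for y z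
    using that can_sym can_pseudotrans unfolding cluster_def by blast
  moreover have "can_rel Box y y" if "y \<in> cluster x" for y
    using that can_refl mcs_cluster[OF x] by blast
  moreover have "cluster x \<noteq> {}"
    unfolding cluster_def by blast
  ultimately show ?thesis
    unfolding diff_frame_def kripke_frame_def trans_def can_frame_def
    by (auto intro: can_trans)
qed

lemma truth:
  assumes x: "mcs x" and "y \<in> cluster x"
  shows "holds (can_frame x) (\<lambda>n. {z \<in> cluster x. Var n \<in> z}) y A \<longleftrightarrow> A \<in> y"
  using assms(2)
proof (induction A arbitrary: y)
  case (Box A)
  then show ?case
    using mcs_cluster[OF x] cluster_Box by (auto simp: can_frame_def Box_iff)
next
  case (DBox A)
  then show ?case
    using mcs_cluster[OF x] cluster_DBox by (auto simp: can_frame_def DBox_iff)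
qed (use mcs_cluster[OF x] in \<open>auto simp: mcs_Imp mcs_Bot\<close>)

lemma canonical_refutation:
  assumes "A \<notin> L"
  obtains F :: "fm set frame" where "diff_frame F" "refuted F A"
    "ax_DS \<in> L \<longrightarrow> DS_frame F" "ax_AT1 \<in> L \<longrightarrow> T1_frame F"
proof -
  have "\<not> {Neg A} \<turnstile> Bot"
  proof
    assume "{Neg A} \<turnstile> Bot"
    then have "{} \<turnstile> Neg (Neg A)" by (rule deduction)
    moreover have "Neg (Neg A) \<^bold>\<rightarrow> A \<in> L" by (rule taut) (simp add: tautology_def)
    ultimately show False using assms derivable_empty derivable.intros by metis
  qed
  then obtain x where x: "mcs x" "{Neg A} \<subseteq> x" by (rule lindenbaum)
  then have "A \<notin> x" using mcs_mp mcs_Bot by blast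
  moreover have "x \<in> cluster x" unfolding cluster_def by blast
  ultimately have "\<not> holds (can_frame x) (\<lambda>n. {z \<in> cluster x. Var n \<in> z}) x A"
    using truth x(1) by blast
  moreover have "valuation (can_frame x) (\<lambda>n. {z \<in> cluster x. Var n \<in> z})"
    unfolding valuation_def can_frame_def by auto
  ultimately have "refuted (can_frame x) A"
    using \<open>x \<in> cluster x\<close> unfolding valid_def by (auto simp: can_frame_def)
  moreover have "DS_frame (can_frame x)" if "ax_DS \<in> L"
    using can_DS[OF that] mcs_cluster[OF x(1)] cluster_DBox
    unfolding DS_frame_def can_frame_def by fastforce
  moreover have "T1_frame (can_frame x)" if "ax_AT1 \<in> L"
    using can_T1[OF that] unfolding T1_frame_def can_frame_def by auto
  ultimately show thesis using that diff_frame_can_frame[OF x(1)] by blast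
qed

lemma finite_frame_refutation:
  assumes "A \<notin> L"
  obtains G :: "nat frame" where "diff_frame G" "finite (worlds G)" "refuted G A"
    "ax_DS \<in> L \<longrightarrow> DS_frame G" "ax_AT1 \<in> L \<longrightarrow> T1_frame G"
  using canonical_refutation[OF assms] finite_refutation by metis

end

section \<open>The finite model property of the three logics\<close>

theorem theorem5p4:
  fixes L :: "fm set"
  assumes "L \<in> {S4D, S4DS, S4DT1S}"
  shows "finite_model_property L"
proof -
  have incl: "S4D \<subseteq> S4DS" "S4DS \<subseteq> S4DT1S"
    unfolding S4DS_def S4DT1S_def by (rule subset_extend)+
  then have "S4D \<subseteq> L" using assms by blast
  moreover have "{ax_B_D, ax_4_D, ax_D_Box, ax_T_Box, ax_4_Box} \<subseteq> S4D"
    unfolding S4D_def by (rule subset_extend)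
  moreover have "is_logic L"
    using assms is_logic_extend unfolding S4D_def S4DS_def S4DT1S_def by blast
  ultimately interpret S4D_logic L by unfold_locales auto
  have "ax_DS \<in> S4DS" "ax_AT1 \<in> S4DT1S"
    unfolding S4DS_def S4DT1S_def using subset_extend(2) by blast+
  \<comment> \<open>Each logic contains the axioms whose frame conditions its soundness lemma
    requires, so the conditional hypotheses cover all three cases.\<close>
  then have valid: "L \<subseteq> {A. valid G A}"
    if "diff_frame G" "ax_DS \<in> L \<longrightarrow> DS_frame G" "ax_AT1 \<in> L \<longrightarrow> T1_frame G" for G :: "nat frame"
    using assms that incl diff_frame_valid_S4D diff_frame_valid_S4DS diff_frame_valid_S4DT1S
    by blast
  show ?thesis
    unfolding finite_model_property_def
  proof (intro allI impI)
    fix A assume "A \<notin> L"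
    then obtain G :: "nat frame" where G: "diff_frame G" "finite (worlds G)" "refuted G A"
      "ax_DS \<in> L \<longrightarrow> DS_frame G" "ax_AT1 \<in> L \<longrightarrow> T1_frame G"
      by (rule finite_frame_refutation)
    then have "kripke_frame G" "\<forall>B \<in> L. valid G B"
      using valid unfolding diff_frame_def by blast+
    then show "\<exists>F :: nat frame. kripke_frame F \<and> finite (worlds F) \<and>
        (\<forall>B \<in> L. valid F B) \<and> refuted F A"
      using G by blast
  qed
qed

end
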